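(* Let $m, r \in \mathbb{N}_{>0}$ and $p \in \mathbb{N}$ with $p \ge rm$. Then $$S_r(p,m) = \frac{p!}{m!\,(r!)^m\,(p-rm)!}\,\mathcal{M}_r(p-rm,m).$$
   Context: $\mathbb{N}$ denotes the nonnegative integers and $\mathbb{N}_{>0}$ the positive integers. For $r \in \mathbb{N}_{>0}$, the $r$-associated Stirling number of the second kind $S_r(p,m)$ is the number of (unordered) partitions of the set $\{1,\dots,p\}$ into $m$ subsets, each of which contains at least $r$ elements. For $r \in \mathbb{N}_{>0}$, the beta distribution with parameters $(1,r)$ is the probability distribution on $\mathbb{R}$ with density $g_r(x) = r(1-x)^{r-1}$ if $x \in [0,1]$ and $g_r(x) = 0$ otherwise (with $0^0=1$). For $k \in \mathbb{N}$ and $m \in \mathbb{N}_{>0}$, define $$\mathcal{M}_r(k,m) = \mathbb{E}\left[(X_1+\dots+X_m)^k\right],$$ where $X_1,\dots,X_m$ are independent random variables each having the beta$(1,r)$ distribution. *)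

theory Defs
  imports "HOL-Probability.Probability" "HOL-Library.Disjoint_Sets"
begin

definition assoc_Stirling :: "nat \<Rightarrow> nat \<Rightarrow> nat \<Rightarrow> nat" where
  "assoc_Stirling r p m =
     card {P. partition_on {1..p} P \<and> card P = m \<and> (\<forall>A\<in>P. r \<le> card A)}"

definition beta_density :: "nat \<Rightarrow> real \<Rightarrow> real" where
  "beta_density r x = (if x \<in> {0..1} then real r * (1 - x) ^ (r - 1) else 0)"

definition beta_measure :: "nat \<Rightarrow> real measure" where
  "beta_measure r = density lborel (\<lambda>x. ennreal (beta_density r x))"

text \<open>The expectation is taken on the canonical realisation, where \<open>X\<^sub>i\<close> is the
  \<open>i\<close>-th coordinate on the product of \<open>m\<close> copies of the beta distribution. Lemma
  \<open>beta_moment_eq_expectation\<close> shows that every other realisation gives the same value.\<close>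

definition beta_moment :: "nat \<Rightarrow> nat \<Rightarrow> nat \<Rightarrow> real" where
  "beta_moment r k m =
     prob_space.expectation (\<Pi>\<^sub>M i\<in>{1..m}. beta_measure r) (\<lambda>x. (\<Sum>i=1..m. x i) ^ k)"

lemma beta_density_measurable [measurable]: "beta_density r \<in> borel_measurable borel"
  unfolding beta_density_def by measurable

lemma sets_beta_measure [simp, measurable_cong]: "sets (beta_measure r) = sets borel"
  by (simp add: beta_measure_def)

lemma prob_space_beta_measure:
  assumes "r > 0"
  shows "prob_space (beta_measure r)"
proof
  have "emeasure (beta_measure r) (space (beta_measure r)) = (\<integral>\<^sup>+x. ennreal (beta_density r x) \<partial>lborel)"
    by (simp add: beta_measure_def emeasure_density)
  also have "\<dots> = (\<integral>\<^sup>+x. ennreal (real r * (1 - x) ^ (r - 1)) * indicator {0..1} x \<partial>lborel)"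
    by (intro nn_integral_cong) (auto simp: beta_density_def indicator_def)
  also have "\<dots> = ennreal (- ((1 - 1) ^ r) - (- ((1 - 0) ^ r)))"
    by (rule nn_integral_FTC_Icc) (auto intro!: derivative_eq_intros)
  also have "\<dots> = 1"
    using assms by simp
  finally show "emeasure (beta_measure r) (space (beta_measure r)) = 1" .
qed

lemma beta_moment_eq_expectation:
  fixes X :: "nat \<Rightarrow> 'a \<Rightarrow> real"
  assumes "prob_space M" and "m > 0"
    and indep: "prob_space.indep_vars M (\<lambda>_. borel) X {1..m}"
    and distr: "\<And>i. i \<in> {1..m} \<Longrightarrow> distributed M lborel (X i) (\<lambda>x. ennreal (beta_density r x))"
  shows "beta_moment r k m = prob_space.expectation M (\<lambda>\<omega>. (\<Sum>i=1..m. X i \<omega>) ^ k)"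
proof -
  interpret prob_space M by fact
  have X: "random_variable borel (X i)" if "i \<in> {1..m}" for i
    using indep that unfolding indep_vars_def by blast
  have "(\<Pi>\<^sub>M i\<in>{1..m}. beta_measure r) = (\<Pi>\<^sub>M i\<in>{1..m}. distr M borel (X i))"
  proof (intro PiM_cong refl)
    fix i assume i: "i \<in> {1..m}"
    have "distr M borel (X i) = distr M lborel (X i)"
      by (intro distr_cong) auto
    then show "beta_measure r = distr M borel (X i)"
      using distr[OF i] by (simp add: distributed_def beta_measure_def)
  qed
  also have "\<dots> = distr M (\<Pi>\<^sub>M i\<in>{1..m}. borel) (\<lambda>\<omega>. \<lambda>i\<in>{1..m}. X i \<omega>)"
    using indep_vars_iff_distr_eq_PiM'[where I = "{1..m}" and M' = "\<lambda>_. borel" and X = X] X indep \<open>m > 0\<close> by auto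
  finally have *: "(\<Pi>\<^sub>M i\<in>{1..m}. beta_measure r) =
    distr M (\<Pi>\<^sub>M i\<in>{1..m}. borel) (\<lambda>\<omega>. \<lambda>i\<in>{1..m}. X i \<omega>)" .
  show ?thesis
    unfolding beta_moment_def * using X
    by (subst integral_distr) (auto intro!: measurable_restrict)
qed

end

theory Submission
  imports Defs
begin

text \<open>Both sides satisfy the same recursion in \<open>m\<close>. Counting pairs of a partition and one of its
  blocks \<open>B\<close> by the block gives
  \<open>(m + 1) S\<^sub>r(p, m + 1) = (\<Sum>j\<ge>r. (p choose j) S\<^sub>r(p - j, m))\<close>. On the other side, splitting off
  \<open>X\<^bsub>m+1\<^esub>\<close> with the binomial theorem makes \<open>M\<^sub>r(k, m) / k!\<close> a convolution power of
  \<open>E[X\<^sup>j] / j! = r! / (r + j)!\<close>, the same recursion after shifting \<open>j\<close> by \<open>r\<close>.\<close>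

section \<open>Counting partitions through a distinguished block\<close>

lemma card_assoc_partitions_Suc:
  fixes A :: "'a set"
  assumes "finite A" and "r > 0"
  shows "Suc m * card {P. partition_on A P \<and> card P = Suc m \<and> (\<forall>B\<in>P. r \<le> card B)} =
    (\<Sum>B | B \<subseteq> A \<and> r \<le> card B.
      card {P. partition_on (A - B) P \<and> card P = m \<and> (\<forall>C\<in>P. r \<le> card C)})"
proof -
  define Q where "Q A m = {P. partition_on A P \<and> card P = m \<and> (\<forall>B\<in>P. r \<le> card B)}"
    for A :: "'a set" and m
  have fin: "finite (Q A' k)" if "A' \<subseteq> A" for A' k
    using finitely_many_partition_on[of A'] finite_subset[OF that \<open>finite A\<close>]
    by (auto simp: Q_def)
  have finP: "finite P" if "P \<in> Q A k" for P k
    using that finite_elements[OF \<open>finite A\<close>] by (auto simp: Q_def)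
  have "Suc m * card (Q A (Suc m)) = (\<Sum>P\<in>Q A (Suc m). card P)"
    by (simp add: Q_def)
  also have "\<dots> = card (SIGMA P:Q A (Suc m). P)"
    using fin finP by (subst card_SigmaI) auto
  also have "\<dots> = card (SIGMA B:{B. B \<subseteq> A \<and> r \<le> card B}. Q (A - B) m)"
  \<comment> \<open>Delete the distinguished block but remember it; the inverse puts it
    back.\<close>
  proof (rule bij_betw_same_card[of "\<lambda>(P, B). (B, P - {B})"],
      rule bij_betw_byWitness[where f' = "\<lambda>(B, P). (insert B P, B)"])
    \<comment> \<open>Since \<open>r > 0\<close>, the block \<open>B\<close> is nonempty and cannot
      lie inside its own complement. Hence inserting it adds exactly one block, and deleting it
      again recovers \<open>P\<close>.\<close>
    have notin: "B \<notin> P" if "partition_on (A - B) P" "r \<le> card B" for P and B :: "'a set"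
    proof
      assume "B \<in> P"
      with that(1) have "B \<subseteq> A - B"
        by (auto simp: partition_on_def)
      with that(2) \<open>r > 0\<close> show False
        by (cases "B = {}") auto
    qed
    then show "\<forall>x\<in>SIGMA B:{B. B \<subseteq> A \<and> r \<le> card B}. Q (A - B) m.
        (\<lambda>(P, B). (B, P - {B})) ((\<lambda>(B, P). (insert B P, B)) x) = x"
      by (auto simp: Q_def)
    show "(\<lambda>(P, B). (B, P - {B})) ` (SIGMA P:Q A (Suc m). P)
        \<subseteq> (SIGMA B:{B. B \<subseteq> A \<and> r \<le> card B}. Q (A - B) m)"
    proof (rule image_subsetI)
      fix x assume "x \<in> (SIGMA P:Q A (Suc m). P)"
      then obtain P B where x: "x = (P, B)" and PB: "P \<in> Q A (Suc m)" "B \<in> P"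
        by auto
      have part: "partition_on A P"
        using PB by (simp add: Q_def)
      then have "disjnt B C" if "C \<in> P - {B}" for C
        using that PB(2) by (auto simp: partition_on_def disjoint_def disjnt_def)
      then have "\<Union>(P - {B}) = A - B"
        using part PB(2) by (fastforce simp: partition_on_def disjnt_def)
      then have "partition_on (A - B) (P - {B})"
        using part by (auto simp: partition_on_def disjoint_def)
      then have "P - {B} \<in> Q (A - B) m"
        using PB finP[OF PB(1)] by (auto simp: Q_def)
      moreover have "B \<subseteq> A" "r \<le> card B"
        using PB by (auto simp: Q_def partition_on_def)
      ultimately show "(\<lambda>(P, B). (B, P - {B})) x
          \<in> (SIGMA B:{B. B \<subseteq> A \<and> r \<le> card B}. Q (A - B) m)"
        by (simp add: x)
    qed
    show "(\<lambda>(B, P). (insert B P, B)) ` (SIGMA B:{B. B \<subseteq> A \<and> r \<le> card B}. Q (A - B) m)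
        \<subseteq> (SIGMA P:Q A (Suc m). P)"
    proof (rule image_subsetI)
      fix x assume "x \<in> (SIGMA B:{B. B \<subseteq> A \<and> r \<le> card B}. Q (A - B) m)"
      then obtain B P where x: "x = (B, P)" and B: "B \<subseteq> A" "r \<le> card B"
        and P: "P \<in> Q (A - B) m"
        by auto
      have part: "partition_on (A - B) P"
        using P by (simp add: Q_def)
      have "finite P"
        using finite_elements[OF _ part] \<open>finite A\<close> by simp
      moreover have "partition_on A (insert B P)"
        using part B \<open>r > 0\<close> by (auto simp: partition_on_def disjoint_def)
      ultimately have "insert B P \<in> Q A (Suc m)"
        using P B notin[OF part B(2)] by (auto simp: Q_def)
      then show "(\<lambda>(B, P). (insert B P, B)) x \<in> (SIGMA P:Q A (Suc m). P)"
        by (simp add: x)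
    qed
  qed auto
  also have "\<dots> = (\<Sum>B | B \<subseteq> A \<and> r \<le> card B. card (Q (A - B) m))"
    using fin \<open>finite A\<close> by (subst card_SigmaI) auto
  finally show ?thesis
    by (simp add: Q_def)
qed

text \<open>The block sizes add up to \<open>card A\<close>, and \<open>m\<close> blocks of size at
  least \<open>r\<close> use up \<open>r * m\<close> elements. This disposes of the blocks
  \<open>B\<close> in the recursion that leave too little room for the others.\<close>

lemma card_assoc_partitions_eq_0:
  assumes "finite A" and "card A < r * m"
  shows "card {P. partition_on A P \<and> card P = m \<and> (\<forall>B\<in>P. r \<le> card B)} = 0"
proof -
  have False if P: "partition_on A P" "card P = m" "\<forall>B\<in>P. r \<le> card B" for P
  proof -
    have "r * m = (\<Sum>B\<in>P. r)"
      using P(2) by simp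
    also have "\<dots> \<le> (\<Sum>B\<in>P. card B)"
      using P(3) by (intro sum_mono) auto
    also have "\<dots> = card A"
      using P(1) \<open>finite A\<close>
      by (intro product_partition[OF P(1), symmetric])
        (auto simp: partition_on_def intro: finite_subset)
    finally show False
      using assms(2) by simp
  qed
  then have "{P. partition_on A P \<and> card P = m \<and> (\<forall>B\<in>P. r \<le> card B)} = {}"
    by blast
  then show ?thesis
    by (metis card.empty)
qed

text \<open>Serves to turn the sum over blocks into a binomial sum, because the count on
  \<open>A - B\<close> depends on \<open>B\<close> only through its size.\<close>

lemma sum_subsets_by_card:
  fixes g :: "nat \<Rightarrow> 'b::comm_semiring_1"
  assumes "finite A"
  shows "(\<Sum>B | B \<subseteq> A \<and> r \<le> card B. g (card B)) =
    (\<Sum>j=r..card A. of_nat (card A choose j) * g j)"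
proof -
  have fin: "finite {B. B \<subseteq> A \<and> r \<le> card B}"
    using assms by simp
  have "(\<Sum>B | B \<subseteq> A \<and> r \<le> card B. g (card B)) =
      (\<Sum>j=r..card A. \<Sum>B\<in>{B \<in> {B. B \<subseteq> A \<and> r \<le> card B}. card B = j}. g (card B))"
    using assms by (intro sum.group[symmetric] fin) (auto intro: card_mono)
  also have "\<dots> = (\<Sum>j=r..card A. \<Sum>B | B \<subseteq> A \<and> card B = j. g j)"
    by (intro sum.cong) auto
  also have "\<dots> = (\<Sum>j=r..card A. of_nat (card A choose j) * g j)"
    using assms by (simp add: n_subsets)
  finally show ?thesis .
qed

section \<open>Moments of a single beta variable\<close>

lemma AE_beta_measure: "AE x in beta_measure r. x \<in> {0..1}"
proof -
  have "beta_density r x > 0 \<longrightarrow> x \<in> {0..1}" for x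
    by (simp add: beta_density_def)
  then show ?thesis
    unfolding beta_measure_def by (subst AE_density) simp_all
qed

lemma integrable_beta_measure_power:
  assumes "r > 0"
  shows "integrable (beta_measure r) (\<lambda>x. x ^ k)"
proof -
  interpret prob_space "beta_measure r"
    by (rule prob_space_beta_measure) fact
  show ?thesis
  proof (rule integrable_const_bound[where B = 1])
    show "AE x in beta_measure r. norm (x ^ k) \<le> 1"
      using AE_beta_measure by eventually_elim (auto simp: power_le_one)
  qed simp
qed

text \<open>This is \<open>r\<close> times the Beta function value B(k + 1, r), obtained by
  induction on \<open>k\<close> from a recurrence between consecutive moments.\<close>

lemma integral_beta_measure_power:
  assumes "r > 0"
  shows "(\<integral>x. x ^ k \<partial>beta_measure r) = fact k * fact r / fact (r + k)"
proof (induction k)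
  case 0
  interpret prob_space "beta_measure r"
    by (rule prob_space_beta_measure) fact
  show ?case
    by (simp add: prob_space)
next
  case (Suc k)
  obtain s where s: "r = Suc s"
    using assms gr0_conv_Suc by auto
  \<comment> \<open>\<open>F\<close> vanishes at 0 and 1, so integrating its derivative gives
    \<open>(k + 1 + r) E[X\<^bsup>k+1\<^esup>] = (k + 1) E[X\<^sup>k]\<close>.\<close>
  define F where "F x = x ^ Suc k * (1 - x) ^ r" for x :: real
  define f where
    "f x = real (Suc k) * x ^ k * (1 - x) ^ r - real r * x ^ Suc k * (1 - x) ^ (r - 1)" for x :: real
  have deriv: "(F has_real_derivative f x) (at x)" for x
    unfolding F_def f_def
    by (auto intro!: derivative_eq_intros simp del: power_Suc simp: algebra_simps)
  have cont: "isCont f x" for x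
    unfolding f_def by (intro continuous_intros)
  \<comment> \<open>Factoring the density out of \<open>f\<close>, by (1 - x)^r = (1 - x)^(r - 1) (1
    - x), turns its integral over the unit interval into an expectation.\<close>
  have f: "f x = real r * (1 - x) ^ (r - 1) *
      (real (Suc k) / real r * x ^ k - real (Suc k + r) / real r * x ^ Suc k)" for x
  proof -
    have *: "real r * q * (u / real r * a - v / real r * b) = q * (u * a - v * b)" for q u v a b :: real
      using assms by (simp add: algebra_simps)
    show ?thesis
      unfolding * unfolding f_def s by (simp add: algebra_simps)
  qed
  have "(\<integral>x. f x * indicator {0..1} x \<partial>lborel) = F 1 - F 0"
    using deriv cont by (intro integral_FTC_Icc_real) auto
  also have "\<dots> = 0"
    using assms by (simp add: F_def)
  also have "(\<integral>x. f x * indicator {0..1} x \<partial>lborel) =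
      (\<integral>x. beta_density r x * (real (Suc k) / real r * x ^ k -
        real (Suc k + r) / real r * x ^ Suc k) \<partial>lborel)"
    by (intro Bochner_Integration.integral_cong refl)
      (auto simp: f beta_density_def)
  also have "\<dots> = (\<integral>x. real (Suc k) / real r * x ^ k -
        real (Suc k + r) / real r * x ^ Suc k \<partial>beta_measure r)"
    unfolding beta_measure_def
    by (subst integral_real_density) (auto simp: beta_density_def)
  also have "\<dots> = real (Suc k) / real r * (\<integral>x. x ^ k \<partial>beta_measure r) -
        real (Suc k + r) / real r * (\<integral>x. x ^ Suc k \<partial>beta_measure r)"
    using integrable_beta_measure_power[OF assms, of k]
      integrable_beta_measure_power[OF assms, of "Suc k"]
    by (subst Bochner_Integration.integral_diff)
      (auto simp del: power_Suc intro!: integrable_mult_right)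
  finally have "real (Suc k + r) * (\<integral>x. x ^ Suc k \<partial>beta_measure r) =
      real (Suc k) * (\<integral>x. x ^ k \<partial>beta_measure r)"
    using assms by (simp add: diff_divide_distrib[symmetric] del: power_Suc of_nat_Suc)
  then have "(\<integral>x. x ^ Suc k \<partial>beta_measure r) =
      real (Suc k) * (fact k * fact r / fact (r + k)) / real (Suc k + r)"
    by (simp add: Suc nonzero_eq_divide_eq mult_ac del: power_Suc of_nat_Suc)
  then show ?case
    by (simp add: add.commute mult.commute del: power_Suc)
qed

section \<open>Moments of sums of independent beta variables\<close>

text \<open>Almost surely every coordinate lies in the unit interval, so the sum lies between 0 and
  \<open>card I\<close>.\<close>

lemma integrable_beta_sum_power:
  assumes "r > 0" and "finite I"
  shows "integrable (\<Pi>\<^sub>M i\<in>I. beta_measure r) (\<lambda>x. (\<Sum>i\<in>I. x i) ^ k)"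
proof -
  interpret prob_space "\<Pi>\<^sub>M i\<in>I. beta_measure r"
    by (intro prob_space_PiM prob_space_beta_measure assms)
  have "AE x in (\<Pi>\<^sub>M i\<in>I. beta_measure r). \<forall>i\<in>I. x i \<in> {0..1}"
    using assms by (intro AE_finite_allI AE_PiM_component prob_space_beta_measure AE_beta_measure)
  then have "AE x in (\<Pi>\<^sub>M i\<in>I. beta_measure r). norm ((\<Sum>i\<in>I. x i) ^ k) \<le> real (card I) ^ k"
  proof eventually_elim
    case (elim x)
    then have "0 \<le> (\<Sum>i\<in>I. x i)" "(\<Sum>i\<in>I. x i) \<le> (\<Sum>i\<in>I. 1)"
      by (auto intro!: sum_nonneg sum_mono simp del: sum_constant)
    then show ?case
      by (auto intro: power_mono)
  qed
  then show ?thesis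
    by (rule integrable_const_bound) simp
qed

lemma beta_moment_0: "beta_moment r k 0 = (if k = 0 then 1 else 0)"
  by (auto simp: beta_moment_def PiM_empty power_0_left)

text \<open>Dividing by k! turns the binomial convolution into an ordinary one: the coefficient
  becomes 1 / (j! (k - j)!), and its j! cancels the one in E[X^j] = j! r! / (r + j)!.\<close>

lemma beta_moment_Suc:
  assumes "r > 0"
  shows "beta_moment r k (Suc m) / fact k =
    (\<Sum>j\<le>k. fact r / fact (r + j) * (beta_moment r (k - j) m / fact (k - j)))"
proof -
  interpret product_sigma_finite "\<lambda>_. beta_measure r"
    by (intro product_sigma_finite.intro prob_space_imp_sigma_finite prob_space_beta_measure assms)
  let ?M = "\<Pi>\<^sub>M i\<in>{1..m}. beta_measure r"
  have ins: "{1..Suc m} = insert (Suc m) {1..m}"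
    by auto
  have int: "integrable ?M (\<lambda>x. (\<Sum>i=1..m. x i) ^ n)" for n
    by (intro integrable_beta_sum_power assms) simp
  \<comment> \<open>Fubini, with the new coordinate integrated first; the sum of the old ones is
    then a constant in the inner integral.\<close>
  have "beta_moment r k (Suc m) =
      (\<integral>x. (\<integral>y. (\<Sum>i\<in>insert (Suc m) {1..m}. (x(Suc m := y)) i) ^ k \<partial>beta_measure r) \<partial>?M)"
    unfolding beta_moment_def ins
    using integrable_beta_sum_power[OF assms, of "insert (Suc m) {1..m}" k]
    by (subst product_integral_insert) auto
  also have "\<dots> = (\<integral>x. (\<integral>y. (y + (\<Sum>i=1..m. x i)) ^ k \<partial>beta_measure r) \<partial>?M)"
    by (simp cong: sum.cong_simp)
  also have "\<dots> = (\<integral>x. (\<Sum>j\<le>k. real (k choose j) * (\<integral>y. y ^ j \<partial>beta_measure r) *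
      (\<Sum>i=1..m. x i) ^ (k - j)) \<partial>?M)"
    using integrable_beta_measure_power[OF assms]
    by (simp add: binomial_ring integrable_mult_right integrable_mult_left)
  also have "\<dots> = (\<Sum>j\<le>k. real (k choose j) * (fact j * fact r / fact (r + j)) *
      beta_moment r (k - j) m)"
    using int by (simp add: beta_moment_def integral_beta_measure_power[OF assms])
  finally show ?thesis
    by (simp add: sum_divide_distrib binomial_fact field_simps)
qed

section \<open>The closed formula by induction on the number of blocks\<close>

text \<open>Stated for an arbitrary finite set, so that the induction hypothesis applies to the
  complement of a block.\<close>

lemma card_assoc_partitions:
  assumes "finite A" and "r > 0" and "r * m \<le> card A"
  shows "real (card {P. partition_on A P \<and> card P = m \<and> (\<forall>B\<in>P. r \<le> card B)}) =
    fact (card A) / (fact m * fact r ^ m * fact (card A - r * m)) *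
    beta_moment r (card A - r * m) m"
  using assms(1,3)
proof (induction m arbitrary: A)
  case 0
  have "{P. partition_on A P \<and> card P = 0 \<and> (\<forall>B\<in>P. r \<le> card B)} =
      (if A = {} then {{}} else {})"
    using finite_elements[OF \<open>finite A\<close>] by (auto simp: partition_on_def)
  then show ?case
    using 0 by (auto simp: beta_moment_0)
next
  case (Suc m)
  define N where "N A m = real (card {P. partition_on A P \<and> card P = m \<and> (\<forall>B\<in>P. r \<le> card B)})"
    for A :: "'a set" and m
  define c where "c n = fact n / (fact m * fact r ^ m * fact (n - r * m)) * beta_moment r (n - r * m) m"
    for n
  define p where "p = card A"
  define k where "k = p - r * Suc m"
  have p: "p = k + r * m + r"
    using Suc.prems by (simp add: p_def k_def)
  \<comment> \<open>The case split matters: for \<open>n < r * m\<close> truncated subtraction would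
    give \<open>c n\<close> the positive value n! / (m! r!^m), while the count is 0.\<close>
  have N: "N (A - B) m = (if r * m \<le> p - card B then c (p - card B) else 0)" if "B \<subseteq> A" for B
  proof -
    have "card (A - B) = p - card B"
      using that Suc.prems by (simp add: p_def card_Diff_subset finite_subset)
    then show ?thesis
      using Suc.IH[of "A - B"] card_assoc_partitions_eq_0[of "A - B" r m] Suc.prems
      by (auto simp: N_def c_def)
  qed
  have "real (Suc m) * N A (Suc m) = (\<Sum>B | B \<subseteq> A \<and> r \<le> card B. N (A - B) m)"
    using arg_cong[OF card_assoc_partitions_Suc[OF Suc.prems(1) \<open>r > 0\<close>, of m], of real]
    unfolding N_def of_nat_mult of_nat_sum .
  also have "\<dots> = (\<Sum>B | B \<subseteq> A \<and> r \<le> card B. if r * m \<le> p - card B then c (p - card B) else 0)"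
    by (intro sum.cong) (auto simp: N)
  also have "\<dots> = (\<Sum>j=r..p. real (p choose j) * (if r * m \<le> p - j then c (p - j) else 0))"
    using sum_subsets_by_card[OF Suc.prems(1), of "\<lambda>n. if r * m \<le> p - n then c (p - n) else 0" r]
    by (simp add: p_def)
  \<comment> \<open>A block of more than \<open>r + k\<close> elements leaves fewer than
    \<open>r * m\<close>, so those terms vanish.\<close>
  also have "\<dots> = (\<Sum>j=r..r+k. real (p choose j) * c (p - j))"
    by (rule sum.mono_neutral_cong_right) (auto simp: p)
  also have "\<dots> = (\<Sum>j\<le>k. real (p choose (r + j)) * c (p - (r + j)))"
    by (rule sum.reindex_bij_witness[of _ "\<lambda>j. r + j" "\<lambda>j. j - r"]) auto
  \<comment> \<open>The factor (p - r - j)! in \<open>c\<close> cancels against the binomial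
    coefficient. Expanding by one more r! produces the summand of
    \<open>beta_moment_Suc\<close>.\<close>
  also have "\<dots> = (\<Sum>j\<le>k. fact p / (fact m * fact r ^ Suc m) *
      (fact r / fact (r + j) * (beta_moment r (k - j) m / fact (k - j))))"
  proof (rule sum.cong)
    fix j assume "j \<in> {..k}"
    then have "r + j \<le> p" "p - (r + j) - r * m = k - j"
      by (auto simp: p)
    then show "real (p choose (r + j)) * c (p - (r + j)) = fact p / (fact m * fact r ^ Suc m) *
        (fact r / fact (r + j) * (beta_moment r (k - j) m / fact (k - j)))"
      by (simp add: c_def binomial_fact field_simps)
  qed simp
  also have "\<dots> = fact p / (fact m * fact r ^ Suc m) * (beta_moment r k (Suc m) / fact k)"
    by (simp only: beta_moment_Suc[OF \<open>r > 0\<close>] sum_distrib_left)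
  \<comment> \<open>Dividing by the number \<open>Suc m\<close> of choices of the distinguished
    block completes m! to (m + 1)!.\<close>
  finally have "N A (Suc m) = fact p / (fact (Suc m) * fact r ^ Suc m * fact k) * beta_moment r k (Suc m)"
    by (simp add: field_simps del: of_nat_Suc)
  then show ?case
    by (simp only: N_def k_def p_def)
qed

theorem theorem2p1:
  fixes m r p :: nat
  assumes "m > 0" and "r > 0" and "p \<ge> r * m"
  shows "real (assoc_Stirling r p m) =
    fact p / (fact m * fact r ^ m * fact (p - r * m)) * beta_moment r (p - r * m) m"
  using card_assoc_partitions[of "{1..p}" r m] assms by (simp add: assoc_Stirling_def)

end
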